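(* Let $C\subseteq\{H,R,L,Fa\}$. Then the sequent calculus $\mathbf{STL}(N,D,C)$ has deductive interpolation. That is, for every set of sequents $\mathcal{S}$ and sequent $S$ with $\mathcal{S}\vdash_{\mathbf{STL}(N,D,C)}S$, there is a set of sequents $\mathcal{T}$ such that: - $V(\mathcal{T})\subseteq V(\mathcal{S})\cap V(S)$; - $\mathcal{T}\vdash_{\mathbf{STL}(N,D,C)}S$; - $\mathcal{S}\vdash_{\mathbf{STL}(N,D,C)}T$ for every $T\in\mathcal{T}$.
   Context: Language $\{\wedge,\vee,\to,\top,\bot,\nabla\}$, extended by $\supset$ when $H\in C$. A sequent is $\Gamma\Rightarrow\Delta$ with $\Gamma,\Delta$ finite multisets of formulas and $|\Delta|\le1$; $\nabla\Gamma=\{\nabla\gamma\mid\gamma\in\Gamma\}$. $V(\mathcal{S})$ is the set of propositional atoms occurring in the sequents of $\mathcal{S}$. $\mathbf{STL}$ rules (premises / conclusion): - Axioms: $A\Rightarrow A$; $\bot\Rightarrow$; $\Rightarrow\top$. - Weakening: $\Gamma\Rightarrow\Delta$ / $\Gamma,A\Rightarrow\Delta$; $\Gamma\Rightarrow$ / $\Gamma\Rightarrow A$. - Contraction: $\Gamma,A,A\Rightarrow\Delta$ / $\Gamma,A\Rightarrow\Delta$. - Cut: $\Gamma\Rightarrow A$, $\Pi,A\Rightarrow\Delta$ / $\Pi,\Gamma\Rightarrow\Delta$. - Conjunction: $\Gamma,A\Rightarrow\Delta$ / $\Gamma,A\wedge B\Rightarrow\Delta$ and likewise for $B$; $\Gamma\Rightarrow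 A$, $\Gamma\Rightarrow B$ / $\Gamma\Rightarrow A\wedge B$. - Disjunction: $A\Rightarrow\Delta$, $B\Rightarrow\Delta$ / $A\vee B\Rightarrow\Delta$; $\Gamma\Rightarrow A$ / $\Gamma\Rightarrow A\vee B$ and likewise for $B$. - Modality: $A\Rightarrow B$ / $\nabla A\Rightarrow\nabla B$. - Left implication: $\Gamma\Rightarrow A$, $\Gamma,B\Rightarrow\Delta$ / $\Gamma,\nabla(A\to B)\Rightarrow\Delta$. - Right implication: $\nabla\Gamma,A\Rightarrow B$ / $\Gamma\Rightarrow A\to B$. Additional rules: - (N): $\Gamma\Rightarrow\Delta$ / $\nabla\Gamma\Rightarrow\nabla\Delta$. - (D): $\Gamma,A\Rightarrow\Delta$, $\Gamma,B\Rightarrow\Delta$ / $\Gamma,A\vee B\Rightarrow\Delta$. - (R): $\Gamma\Rightarrow A$ / $\Gamma\Rightarrow\nabla A$. - (L): $\Gamma,A\Rightarrow\Delta$ / $\Gamma,\nabla A\Rightarrow\Delta$. - (Fa): $\Gamma,A\Rightarrow B$ / $\Gamma\Rightarrow\nabla(A\to B)$. - (H): the rules $\Gamma\Rightarrow A$, $\Gamma,B\Rightarrow\Delta$ / $\Gamma,A\supset B\Rightarrow\Delta$ and $\Gamma,A\Rightarrow B$ / $\Gamma\Rightarrow A\supset B$. $\mathbf{STL}(N,D,C)$ is $\mathbf{STL}$ plus these rules. $\mathcal{S}\vdash_G S$ means $S$ is derivable from premises $\mathcal{S}$ using rule instances of $G$. *)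

theory Defs
  imports "HOL-Library.Multiset"
begin

datatype (atoms: 'a) fm =
    Atom 'a
  | Top
  | Bot
  | Conj "'a fm" "'a fm"  (infixr "\<^bold>\<and>" 75)
  | Disj "'a fm" "'a fm"  (infixr "\<^bold>\<or>" 70)
  | Imp "'a fm" "'a fm"  (infixr "\<^bold>\<rightarrow>" 65)
  | Nabla "'a fm"  ("\<nabla> _" [80] 80)
  | HImp "'a fm" "'a fm"  (infixr "\<sqsupset>" 65)

text \<open>Since a succedent has at most one formula, it is represented by an option.\<close>

datatype 'a sequent =
  Sequent (antecedent: "'a fm multiset") (succedent: "'a fm option")  (infix "\<Zrightarrow>" 52)

definition vars :: "'a sequent set \<Rightarrow> 'a set" where
  "vars SS = (\<Union>S\<in>SS. \<Union>(atoms ` (set_mset (antecedent S) \<union> set_option (succedent S))))"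

datatype add_rule = RuleN | RuleD | RuleH | RuleR | RuleL | RuleFa

text \<open>The language of a calculus with additional rules \<open>X\<close> contains the connective
  \<open>\<sqsupset>\<close> only if \<open>X\<close> contains \<open>RuleH\<close>; derivations are confined to that language.\<close>

primrec formula_of :: "add_rule set \<Rightarrow> 'a fm \<Rightarrow> bool" where
  "formula_of X (Atom p) \<longleftrightarrow> True"
| "formula_of X Top \<longleftrightarrow> True"
| "formula_of X Bot \<longleftrightarrow> True"
| "formula_of X (A \<^bold>\<and> B) \<longleftrightarrow> formula_of X A \<and> formula_of X B"
| "formula_of X (A \<^bold>\<or> B) \<longleftrightarrow> formula_of X A \<and> formula_of X B"
| "formula_of X (A \<^bold>\<rightarrow> B) \<longleftrightarrow> formula_of X A \<and> formula_of X B"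
| "formula_of X (\<nabla> A) \<longleftrightarrow> formula_of X A"
| "formula_of X (A \<sqsupset> B) \<longleftrightarrow> RuleH \<in> X \<and> formula_of X A \<and> formula_of X B"

definition sequents_of :: "add_rule set \<Rightarrow> 'a sequent set" where
  "sequents_of X =
    {S. \<forall>A \<in> set_mset (antecedent S) \<union> set_option (succedent S). formula_of X A}"

inductive rule_instance :: "add_rule set \<Rightarrow> 'a sequent list \<Rightarrow> 'a sequent \<Rightarrow> bool"
  for X :: "add_rule set" where
  Id: "rule_instance X [] ({#A#} \<Zrightarrow> Some A)"
| BotL: "rule_instance X [] ({#Bot#} \<Zrightarrow> None)"
| TopR: "rule_instance X [] ({#} \<Zrightarrow> Some Top)"
| WeakL: "rule_instance X [\<Gamma> \<Zrightarrow> \<Delta>] (add_mset A \<Gamma> \<Zrightarrow> \<Delta>)"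
| WeakR: "rule_instance X [\<Gamma> \<Zrightarrow> None] (\<Gamma> \<Zrightarrow> Some A)"
| Contr: "rule_instance X [add_mset A (add_mset A \<Gamma>) \<Zrightarrow> \<Delta>] (add_mset A \<Gamma> \<Zrightarrow> \<Delta>)"
| Cut: "rule_instance X [\<Gamma> \<Zrightarrow> Some A, add_mset A \<Pi> \<Zrightarrow> \<Delta>] (\<Pi> + \<Gamma> \<Zrightarrow> \<Delta>)"
| ConjL1: "rule_instance X [add_mset A \<Gamma> \<Zrightarrow> \<Delta>] (add_mset (A \<^bold>\<and> B) \<Gamma> \<Zrightarrow> \<Delta>)"
| ConjL2: "rule_instance X [add_mset B \<Gamma> \<Zrightarrow> \<Delta>] (add_mset (A \<^bold>\<and> B) \<Gamma> \<Zrightarrow> \<Delta>)"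
| ConjR: "rule_instance X [\<Gamma> \<Zrightarrow> Some A, \<Gamma> \<Zrightarrow> Some B] (\<Gamma> \<Zrightarrow> Some (A \<^bold>\<and> B))"
| DisjL: "rule_instance X [{#A#} \<Zrightarrow> \<Delta>, {#B#} \<Zrightarrow> \<Delta>] ({#A \<^bold>\<or> B#} \<Zrightarrow> \<Delta>)"
| DisjR1: "rule_instance X [\<Gamma> \<Zrightarrow> Some A] (\<Gamma> \<Zrightarrow> Some (A \<^bold>\<or> B))"
| DisjR2: "rule_instance X [\<Gamma> \<Zrightarrow> Some B] (\<Gamma> \<Zrightarrow> Some (A \<^bold>\<or> B))"
| Nab: "rule_instance X [{#A#} \<Zrightarrow> Some B] ({#\<nabla> A#} \<Zrightarrow> Some (\<nabla> B))"
| ImpL: "rule_instance X [\<Gamma> \<Zrightarrow> Some A, add_mset B \<Gamma> \<Zrightarrow> \<Delta>]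
    (add_mset (\<nabla> (A \<^bold>\<rightarrow> B)) \<Gamma> \<Zrightarrow> \<Delta>)"
| ImpR: "rule_instance X [add_mset A (image_mset Nabla \<Gamma>) \<Zrightarrow> Some B] (\<Gamma> \<Zrightarrow> Some (A \<^bold>\<rightarrow> B))"
| N: "RuleN \<in> X \<Longrightarrow>
    rule_instance X [\<Gamma> \<Zrightarrow> \<Delta>] (image_mset Nabla \<Gamma> \<Zrightarrow> map_option Nabla \<Delta>)"
| D: "RuleD \<in> X \<Longrightarrow>
    rule_instance X [add_mset A \<Gamma> \<Zrightarrow> \<Delta>, add_mset B \<Gamma> \<Zrightarrow> \<Delta>] (add_mset (A \<^bold>\<or> B) \<Gamma> \<Zrightarrow> \<Delta>)"
| R: "RuleR \<in> X \<Longrightarrow> rule_instance X [\<Gamma> \<Zrightarrow> Some A] (\<Gamma> \<Zrightarrow> Some (\<nabla> A))"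
| L: "RuleL \<in> X \<Longrightarrow> rule_instance X [add_mset A \<Gamma> \<Zrightarrow> \<Delta>] (add_mset (\<nabla> A) \<Gamma> \<Zrightarrow> \<Delta>)"
| Fa: "RuleFa \<in> X \<Longrightarrow>
    rule_instance X [add_mset A \<Gamma> \<Zrightarrow> Some B] (\<Gamma> \<Zrightarrow> Some (\<nabla> (A \<^bold>\<rightarrow> B)))"
| HL: "RuleH \<in> X \<Longrightarrow>
    rule_instance X [\<Gamma> \<Zrightarrow> Some A, add_mset B \<Gamma> \<Zrightarrow> \<Delta>] (add_mset (A \<sqsupset> B) \<Gamma> \<Zrightarrow> \<Delta>)"
| HR: "RuleH \<in> X \<Longrightarrow>
    rule_instance X [add_mset A \<Gamma> \<Zrightarrow> Some B] (\<Gamma> \<Zrightarrow> Some (A \<sqsupset> B))"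

inductive STL_derives :: "add_rule set \<Rightarrow> 'a sequent set \<Rightarrow> 'a sequent \<Rightarrow> bool"
  for X :: "add_rule set" and SS :: "'a sequent set" where
  premise: "S \<in> SS \<Longrightarrow> STL_derives X SS S"
| step: "rule_instance X Ps S \<Longrightarrow> set Ps \<subseteq> sequents_of X \<Longrightarrow> S \<in> sequents_of X \<Longrightarrow>
    (\<And>P. P \<in> set Ps \<Longrightarrow> STL_derives X SS P) \<Longrightarrow> STL_derives X SS S"

end

theory Submission
  imports Defs
begin

text \<open>
  Let \<open>TT\<close> be the set of all consequences of \<open>SS\<close> in the common variables, and suppose that \<open>TT\<close>
  does not derive \<open>S\<close>. In the presence of \<open>N\<close> and \<open>D\<close> the modality is dual to a function on prime
  theories, \<open>x \<mapsto> {A. \<nabla> A \<in> x}\<close>, and the calculus is sound for Kripke frames \<open>(W, \<le>, \<pi>)\<close> in which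
  \<open>\<nabla>\<close> is inverse image under a monotone \<open>\<pi>\<close>. Amalgamate the two canonical frames: the worlds are the
  pairs \<open>(x, y)\<close> of a prime theory \<open>x\<close> of \<open>SS\<close> in the variables of \<open>SS\<close> and a prime theory \<open>y\<close> of
  \<open>TT\<close> in the variables of \<open>S\<close> that contain the same formulas in the common variables. Both
  projections are surjective bounded morphisms, because \<open>SS\<close> and \<open>TT\<close> have the same consequences in
  the common variables. Hence the pullback is a model of \<open>SS\<close> refuting \<open>S\<close>. The frame conditions
  for \<open>R\<close>, \<open>L\<close> and \<open>Fa\<close> are inherited componentwise.
\<close>

section \<open>Kripke models\<close>

text \<open>Since \<open>\<nabla>\<close> looks at the single world \<open>\<pi> w\<close>, it
  commutes with conjunction, disjunction and \<open>Bot\<close>, which validates \<open>N\<close>.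
  The rules \<open>R\<close>, \<open>L\<close> and \<open>Fa\<close> correspond to
  \<open>\<pi>\<close> being inflationary, deflationary and order-reflecting.\<close>

locale kripke_model =
  fixes X :: "add_rule set" and W :: "'w set" and le :: "'w \<Rightarrow> 'w \<Rightarrow> bool" and \<pi> :: "'w \<Rightarrow> 'w"
    and val :: "'w \<Rightarrow> 'a \<Rightarrow> bool"
  assumes le_refl: "w \<in> W \<Longrightarrow> le w w"
    and le_trans: "\<lbrakk>u \<in> W; v \<in> W; w \<in> W; le u v; le v w\<rbrakk> \<Longrightarrow> le u w"
    and pi_in: "w \<in> W \<Longrightarrow> \<pi> w \<in> W"
    and pi_mono: "\<lbrakk>v \<in> W; w \<in> W; le v w\<rbrakk> \<Longrightarrow> le (\<pi> v) (\<pi> w)"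
    and val_mono: "\<lbrakk>v \<in> W; w \<in> W; le v w; val v p\<rbrakk> \<Longrightarrow> val w p"
    and frame_R: "\<lbrakk>RuleR \<in> X; w \<in> W\<rbrakk> \<Longrightarrow> le w (\<pi> w)"
    and frame_L: "\<lbrakk>RuleL \<in> X; w \<in> W\<rbrakk> \<Longrightarrow> le (\<pi> w) w"
    and frame_Fa: "\<lbrakk>RuleFa \<in> X; v \<in> W; w \<in> W; le (\<pi> v) (\<pi> w)\<rbrakk> \<Longrightarrow> le v w"
begin

text \<open>The clause for \<open>\<rightarrow>\<close> is dictated by adjointness: with the
  relation \<open>le w (\<pi> v)\<close>, A \<rightarrow> B follows from C exactly when B follows
  from \<open>\<nabla> C\<close> and A. The connective \<open>\<sqsupset>\<close> is the
  intuitionistic implication of the preorder.\<close>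

primrec sat :: "'w \<Rightarrow> 'a fm \<Rightarrow> bool" where
  "sat w (Atom p) \<longleftrightarrow> val w p"
| "sat w Top \<longleftrightarrow> True"
| "sat w Bot \<longleftrightarrow> False"
| "sat w (A \<^bold>\<and> B) \<longleftrightarrow> sat w A \<and> sat w B"
| "sat w (A \<^bold>\<or> B) \<longleftrightarrow> sat w A \<or> sat w B"
| "sat w (A \<^bold>\<rightarrow> B) \<longleftrightarrow> (\<forall>v\<in>W. le w (\<pi> v) \<longrightarrow> sat v A \<longrightarrow> sat v B)"
| "sat w (\<nabla> A) \<longleftrightarrow> sat (\<pi> w) A"
| "sat w (A \<sqsupset> B) \<longleftrightarrow> (\<forall>v\<in>W. le w v \<longrightarrow> sat v A \<longrightarrow> sat v B)"

lemma sat_mono: "\<lbrakk>v \<in> W; w \<in> W; le v w; sat v A\<rbrakk> \<Longrightarrow> sat w A"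
proof (induction A arbitrary: v w)
  case (Imp A B)
  then show ?case unfolding sat.simps by (meson le_trans pi_in)
next
  case (HImp A B)
  then show ?case unfolding sat.simps by (meson le_trans)
next
  case (Nabla A)
  then show ?case by (auto intro: pi_in pi_mono)
qed (auto intro: val_mono)

definition valid :: "'a sequent \<Rightarrow> bool" where
  "valid S \<longleftrightarrow> (\<forall>w\<in>W. (\<forall>A\<in>#antecedent S. sat w A) \<longrightarrow> (\<exists>A\<in>set_option (succedent S). sat w A))"

lemma valid_rule_instance:
  assumes "rule_instance X Ps S" "\<forall>P\<in>set Ps. valid P"
  shows "valid S"
  using assms
proof (cases rule: rule_instance.cases)
  case (Cut \<Gamma> A \<Pi> \<Delta>)
  then show ?thesis using assms(2) by (fastforce simp: valid_def)
next
  case (ImpL \<Gamma> A B \<Delta>)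
  then have "valid (\<Gamma> \<Zrightarrow> Some A)" "valid (add_mset B \<Gamma> \<Zrightarrow> \<Delta>)" using assms(2) by auto
  \<comment> \<open>The clause for A \<rightarrow> B at \<open>\<pi> w\<close> is instantiated with
    the world w itself.\<close>
  moreover have "sat w (\<nabla> (A \<^bold>\<rightarrow> B)) \<Longrightarrow> sat w A \<Longrightarrow> sat w B" if "w \<in> W" for w
    using that by (simp add: le_refl pi_in)
  ultimately show ?thesis using ImpL unfolding valid_def by simp
next
  case (ImpR A \<Gamma> B)
  have "valid (add_mset A (image_mset Nabla \<Gamma>) \<Zrightarrow> Some B)"
    using ImpR assms(2) by simp
  then show ?thesis using ImpR by (auto simp: valid_def intro: sat_mono pi_in)
next
  case (N \<Gamma> \<Delta>)
  have "valid (\<Gamma> \<Zrightarrow> \<Delta>)" using N assms(2) by simp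
  then show ?thesis using N by (auto simp: valid_def pi_in option.set_map)
next
  case (R \<Gamma> A)
  then show ?thesis using assms(2) by (auto simp: valid_def intro: sat_mono frame_R pi_in)
next
  case (L A \<Gamma> \<Delta>)
  then show ?thesis using assms(2) by (auto simp: valid_def dest: sat_mono[rotated 3] intro: frame_L pi_in)
next
  case (Fa A \<Gamma> B)
  have "valid (add_mset A \<Gamma> \<Zrightarrow> Some B)" using Fa assms(2) by simp
  \<comment> \<open>A world v that matters for \<open>\<nabla>\<close> (A \<rightarrow> B) at w
    satisfies \<open>le (\<pi> w) (\<pi> v)\<close>. Order reflection turns this into
    \<open>le w v\<close>, so the context persists to v.\<close>
  then show ?thesis using Fa by (auto simp: valid_def intro: sat_mono frame_Fa)
next
  case (HL \<Gamma> A B \<Delta>)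
  then have "valid (\<Gamma> \<Zrightarrow> Some A)" "valid (add_mset B \<Gamma> \<Zrightarrow> \<Delta>)" using assms(2) by auto
  moreover have "sat w (A \<sqsupset> B) \<Longrightarrow> sat w A \<Longrightarrow> sat w B" if "w \<in> W" for w
    using that by (simp add: le_refl)
  ultimately show ?thesis using HL unfolding valid_def by simp
next
  case (HR A \<Gamma> B)
  have "valid (add_mset A \<Gamma> \<Zrightarrow> Some B)" using HR assms(2) by simp
  then show ?thesis using HR by (auto simp: valid_def intro: sat_mono)
qed (auto simp: valid_def pi_in)

lemma soundness:
  assumes "STL_derives X SS S" "\<And>P. P \<in> SS \<Longrightarrow> valid P"
  shows "valid S"
  using assms(1) by induction (auto intro: assms(2) valid_rule_instance)

end

section \<open>Derivability from sets of formulas\<close>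

lemma sequent_in_sequents_of [simp]:
  "\<Gamma> \<Zrightarrow> \<Delta> \<in> sequents_of X \<longleftrightarrow>
    (\<forall>A\<in>#\<Gamma>. formula_of X A) \<and> (\<forall>A\<in>set_option \<Delta>. formula_of X A)"
  by (auto simp: sequents_of_def)

definition language :: "add_rule set \<Rightarrow> 'a set \<Rightarrow> 'a fm set" where
  "language X V = {A. formula_of X A \<and> atoms A \<subseteq> V}"

lemma language_simps [simp]:
  "Atom p \<in> language X V \<longleftrightarrow> p \<in> V"
  "Top \<in> language X V"
  "Bot \<in> language X V"
  "A \<^bold>\<and> B \<in> language X V \<longleftrightarrow> A \<in> language X V \<and> B \<in> language X V"
  "A \<^bold>\<or> B \<in> language X V \<longleftrightarrow> A \<in> language X V \<and> B \<in> language X V"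
  "A \<^bold>\<rightarrow> B \<in> language X V \<longleftrightarrow> A \<in> language X V \<and> B \<in> language X V"
  "\<nabla> A \<in> language X V \<longleftrightarrow> A \<in> language X V"
  "A \<sqsupset> B \<in> language X V \<longleftrightarrow> RuleH \<in> X \<and> A \<in> language X V \<and> B \<in> language X V"
  by (auto simp: language_def)

lemma language_formula_of: "A \<in> language X V \<Longrightarrow> formula_of X A"
  by (simp add: language_def)

lemma language_mono: "V \<subseteq> V' \<Longrightarrow> language X V \<subseteq> language X V'"
  by (auto simp: language_def)

text \<open>Serves to undo the prefixing of \<open>\<nabla>\<close> in the context of
  \<open>ImpR\<close>.\<close>

lemma image_mset_preimage:
  assumes "set_mset M \<subseteq> f ` G"
  obtains N where "set_mset N \<subseteq> G" "image_mset f N = M"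
proof
  show "set_mset (image_mset (inv_into G f) M) \<subseteq> G"
    using assms by (auto intro: inv_into_into)
  have "image_mset (\<lambda>a. f (inv_into G f a)) M = image_mset (\<lambda>a. a) M"
    using assms by (intro image_mset_cong) (auto simp: f_inv_into_f)
  then show "image_mset f (image_mset (inv_into G f) M) = M"
    by (simp add: multiset.map_comp comp_def)
qed

locale stl_theory =
  fixes X :: "add_rule set" and T :: "'a sequent set"
  assumes T_sequents: "T \<subseteq> sequents_of X" and rule_N: "RuleN \<in> X" and rule_D: "RuleD \<in> X"
begin

abbreviation derives :: "'a sequent \<Rightarrow> bool" ("\<turnstile> _" [50] 50) where
  "\<turnstile> S \<equiv> STL_derives X T S"

text \<open>As the premises in T belong to the language, so does everything derivable; the rule
  lemmas below then have to check only their conclusion.\<close>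

lemma derives_sequents_of: "\<turnstile> S \<Longrightarrow> S \<in> sequents_of X"
  by (induction rule: STL_derives.induct) (use T_sequents in auto)

lemma derives_step0: "\<lbrakk>rule_instance X [] S; S \<in> sequents_of X\<rbrakk> \<Longrightarrow> \<turnstile> S"
  by (rule STL_derives.step) auto

lemma derives_step1: "\<lbrakk>rule_instance X [P] S; \<turnstile> P; S \<in> sequents_of X\<rbrakk> \<Longrightarrow> \<turnstile> S"
  by (rule STL_derives.step) (auto dest: derives_sequents_of)

lemma derives_step2: "\<lbrakk>rule_instance X [P, Q] S; \<turnstile> P; \<turnstile> Q; S \<in> sequents_of X\<rbrakk> \<Longrightarrow> \<turnstile> S"
  by (rule STL_derives.step) (auto dest: derives_sequents_of)

lemma derives_weaken:
  "\<lbrakk>\<turnstile> \<Gamma> \<Zrightarrow> \<Delta>; \<forall>A\<in>#\<Gamma>'. formula_of X A\<rbrakk> \<Longrightarrow> \<turnstile> \<Gamma> + \<Gamma>' \<Zrightarrow> \<Delta>"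
proof (induction \<Gamma>')
  case (add A \<Gamma>')
  then have "\<turnstile> \<Gamma> + \<Gamma>' \<Zrightarrow> \<Delta>" by simp
  then show ?case using add.prems derives_sequents_of[of "\<Gamma> + \<Gamma>' \<Zrightarrow> \<Delta>"]
    by (auto intro!: derives_step1[OF rule_instance.WeakL])
qed simp

lemma derives_contract:
  "\<lbrakk>\<turnstile> \<Gamma> + \<Gamma>' \<Zrightarrow> \<Delta>; set_mset \<Gamma> \<subseteq> set_mset \<Gamma>'\<rbrakk> \<Longrightarrow> \<turnstile> \<Gamma>' \<Zrightarrow> \<Delta>"
proof (induction \<Gamma>)
  case (add A \<Gamma>)
  then obtain \<Gamma>'' where \<Gamma>': "\<Gamma>' = add_mset A \<Gamma>''"
    by (metis insert_DiffM insert_subset set_mset_add_mset_insert)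
  have "\<turnstile> add_mset A (\<Gamma> + \<Gamma>'') \<Zrightarrow> \<Delta>"
    by (rule derives_step1[OF rule_instance.Contr])
      (use add.prems \<Gamma>' derives_sequents_of[OF add.prems(1)] in auto)
  then show ?case using add \<Gamma>' by simp
qed simp

text \<open>Contexts may be treated as sets: weakening adds all of \<open>\<Gamma>'\<close>, and
  contraction then removes the old copy of \<open>\<Gamma>\<close>.\<close>

lemma derives_antecedent_mono:
  assumes "\<turnstile> \<Gamma> \<Zrightarrow> \<Delta>" "set_mset \<Gamma> \<subseteq> set_mset \<Gamma>'" "\<forall>A\<in>#\<Gamma>'. formula_of X A"
  shows "\<turnstile> \<Gamma>' \<Zrightarrow> \<Delta>"
  using derives_contract[OF derives_weaken[OF assms(1,3)] assms(2)] .

text \<open>The members of G are local hypotheses, the sequents of T global premises. G may be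
  infinite, but each entailment uses a finite context; this compactness is what Zorn's lemma relies
  on later.\<close>

definition entails :: "'a fm set \<Rightarrow> 'a fm \<Rightarrow> bool"  (infix "\<tturnstile>" 50) where
  "G \<tturnstile> A \<longleftrightarrow> (\<exists>\<Gamma>. set_mset \<Gamma> \<subseteq> G \<and> \<turnstile> \<Gamma> \<Zrightarrow> Some A)"

lemma entails_mono: "\<lbrakk>G \<tturnstile> A; G \<subseteq> H\<rbrakk> \<Longrightarrow> H \<tturnstile> A"
  unfolding entails_def by blast

lemma entails_formula_of: "G \<tturnstile> A \<Longrightarrow> formula_of X A"
  unfolding entails_def by (auto dest: derives_sequents_of)

lemma entailsI: "\<turnstile> \<Gamma> \<Zrightarrow> Some A \<Longrightarrow> set_mset \<Gamma> \<subseteq> G \<Longrightarrow> G \<tturnstile> A"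
  unfolding entails_def by blast

lemma entails_assumption: "\<lbrakk>A \<in> G; formula_of X A\<rbrakk> \<Longrightarrow> G \<tturnstile> A"
  by (rule entailsI[OF derives_step0[OF rule_instance.Id]]) auto

lemma entails_insertE:
  assumes "insert A G \<tturnstile> B" "formula_of X A"
  obtains \<Pi> where "set_mset \<Pi> \<subseteq> G" "\<turnstile> add_mset A \<Pi> \<Zrightarrow> Some B"
proof -
  from assms obtain \<Gamma> where \<Gamma>: "set_mset \<Gamma> \<subseteq> insert A G" "\<turnstile> \<Gamma> \<Zrightarrow> Some B"
    unfolding entails_def by blast
  show ?thesis
  proof
    show "set_mset {#C \<in># \<Gamma>. C \<noteq> A#} \<subseteq> G" using \<Gamma> by auto
    show "\<turnstile> add_mset A {#C \<in># \<Gamma>. C \<noteq> A#} \<Zrightarrow> Some B"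
      by (rule derives_antecedent_mono[OF \<Gamma>(2)])
        (use derives_sequents_of[OF \<Gamma>(2)] assms(2) in auto)
  qed
qed

lemma entails_cut:
  assumes "G \<tturnstile> A" "insert A G \<tturnstile> B"
  shows "G \<tturnstile> B"
proof -
  obtain \<Gamma> where \<Gamma>: "set_mset \<Gamma> \<subseteq> G" "\<turnstile> \<Gamma> \<Zrightarrow> Some A" using assms(1) unfolding entails_def by blast
  obtain \<Pi> where \<Pi>: "set_mset \<Pi> \<subseteq> G" "\<turnstile> add_mset A \<Pi> \<Zrightarrow> Some B"
    using entails_insertE[OF assms(2) entails_formula_of[OF assms(1)]] .
  have "\<turnstile> \<Pi> + \<Gamma> \<Zrightarrow> Some B"
    by (rule derives_step2[OF rule_instance.Cut \<Gamma>(2) \<Pi>(2)])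
      (use derives_sequents_of[OF \<Gamma>(2)] derives_sequents_of[OF \<Pi>(2)] in auto)
  then show ?thesis by (rule entailsI) (use \<Gamma> \<Pi> in auto)
qed

lemma entails_trans: "\<lbrakk>G \<tturnstile> A; {A} \<tturnstile> B\<rbrakk> \<Longrightarrow> G \<tturnstile> B"
  by (rule entails_cut) (auto elim: entails_mono)

lemma entails_trans2: "\<lbrakk>G \<tturnstile> A; G \<tturnstile> B; {A, B} \<tturnstile> C\<rbrakk> \<Longrightarrow> G \<tturnstile> C"
  by (rule entails_cut[of _ A], assumption, rule entails_cut[of _ B]) (auto elim: entails_mono)

lemma entails_Top: "G \<tturnstile> Top"
  by (rule entailsI[OF derives_step0[OF rule_instance.TopR]]) auto

lemma derives_None_iff: "\<turnstile> \<Gamma> \<Zrightarrow> None \<longleftrightarrow> \<turnstile> \<Gamma> \<Zrightarrow> Some Bot"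
proof
  assume "\<turnstile> \<Gamma> \<Zrightarrow> None"
  then show "\<turnstile> \<Gamma> \<Zrightarrow> Some Bot"
    using derives_sequents_of[of "\<Gamma> \<Zrightarrow> None"] by (auto intro: derives_step1[OF rule_instance.WeakR])
next
  assume *: "\<turnstile> \<Gamma> \<Zrightarrow> Some Bot"
  have "\<turnstile> {#} + \<Gamma> \<Zrightarrow> None"
    by (rule derives_step2[OF rule_instance.Cut * derives_step0[OF rule_instance.BotL]])
      (use derives_sequents_of[OF *] in auto)
  then show "\<turnstile> \<Gamma> \<Zrightarrow> None" by simp
qed

section \<open>Entailments for the connectives and the additional rules\<close>

lemma entails_Bot: "formula_of X A \<Longrightarrow> {Bot} \<tturnstile> A"
  by (rule entailsI[OF derives_step1[OF rule_instance.WeakR derives_step0[OF rule_instance.BotL]]]) auto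

lemma entails_Conj1: "\<lbrakk>formula_of X A; formula_of X B\<rbrakk> \<Longrightarrow> {A \<^bold>\<and> B} \<tturnstile> A"
  by (rule entailsI[OF derives_step1[OF rule_instance.ConjL1 derives_step0[OF rule_instance.Id]]]) auto

lemma entails_Conj2: "\<lbrakk>formula_of X A; formula_of X B\<rbrakk> \<Longrightarrow> {A \<^bold>\<and> B} \<tturnstile> B"
  by (rule entailsI[OF derives_step1[OF rule_instance.ConjL2 derives_step0[OF rule_instance.Id]]]) auto

lemma entails_ConjI:
  assumes "formula_of X A" "formula_of X B"
  shows "{A, B} \<tturnstile> A \<^bold>\<and> B"
proof -
  have "\<turnstile> {#A, B#} \<Zrightarrow> Some A" "\<turnstile> {#A, B#} \<Zrightarrow> Some B"
    by (rule derives_antecedent_mono[OF derives_step0[OF rule_instance.Id]]; use assms in auto)+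
  then show ?thesis
    by (intro entailsI[OF derives_step2[OF rule_instance.ConjR]]) (use assms in auto)
qed

lemma entails_Disj1: "\<lbrakk>formula_of X A; formula_of X B\<rbrakk> \<Longrightarrow> {A} \<tturnstile> A \<^bold>\<or> B"
  by (rule entailsI[OF derives_step1[OF rule_instance.DisjR1 derives_step0[OF rule_instance.Id]]]) auto

lemma entails_Disj2: "\<lbrakk>formula_of X A; formula_of X B\<rbrakk> \<Longrightarrow> {B} \<tturnstile> A \<^bold>\<or> B"
  by (rule entailsI[OF derives_step1[OF rule_instance.DisjR2 derives_step0[OF rule_instance.Id]]]) auto

text \<open>The basic left rule for disjunction has no context, so the step goes through
  \<open>D\<close>, after weakening has merged the contexts of both cases.\<close>

lemma entails_DisjE:
  assumes "insert A G \<tturnstile> C" "insert B G \<tturnstile> C" "formula_of X A" "formula_of X B"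
  shows "insert (A \<^bold>\<or> B) G \<tturnstile> C"
proof -
  obtain \<Pi>1 where \<Pi>1: "set_mset \<Pi>1 \<subseteq> G" "\<turnstile> add_mset A \<Pi>1 \<Zrightarrow> Some C"
    using entails_insertE[OF assms(1,3)] .
  obtain \<Pi>2 where \<Pi>2: "set_mset \<Pi>2 \<subseteq> G" "\<turnstile> add_mset B \<Pi>2 \<Zrightarrow> Some C"
    using entails_insertE[OF assms(2,4)] .
  note wf = derives_sequents_of[OF \<Pi>1(2)] derives_sequents_of[OF \<Pi>2(2)]
  have "\<turnstile> add_mset A (\<Pi>1 + \<Pi>2) \<Zrightarrow> Some C"
    by (rule derives_antecedent_mono[OF \<Pi>1(2)]) (use wf in auto)
  moreover have "\<turnstile> add_mset B (\<Pi>1 + \<Pi>2) \<Zrightarrow> Some C"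
    by (rule derives_antecedent_mono[OF \<Pi>2(2)]) (use wf in auto)
  ultimately show ?thesis
    by (intro entailsI[OF derives_step2[OF rule_instance.D[OF rule_D, of A _ _ B]]]) (use wf \<Pi>1 \<Pi>2 in auto)
qed

lemma entails_ImpE:
  assumes "formula_of X A" "formula_of X B"
  shows "{\<nabla> (A \<^bold>\<rightarrow> B), A} \<tturnstile> B"
proof -
  have "\<turnstile> {#B, A#} \<Zrightarrow> Some B"
    by (rule derives_antecedent_mono[OF derives_step0[OF rule_instance.Id]]) (use assms in auto)
  then show ?thesis
    by (intro entailsI[OF derives_step2[OF rule_instance.ImpL[of _ _ A] derives_step0[OF rule_instance.Id]]])
      (use assms in auto)
qed

text \<open>\<open>ImpR\<close> reads its context under \<open>\<nabla>\<close>, so the hypotheses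
  from G are available in the premise only in that form.\<close>

lemma entails_ImpI:
  assumes "insert A (Nabla ` G) \<tturnstile> B" "formula_of X A"
  shows "G \<tturnstile> A \<^bold>\<rightarrow> B"
proof -
  obtain \<Pi> where \<Pi>: "set_mset \<Pi> \<subseteq> Nabla ` G" "\<turnstile> add_mset A \<Pi> \<Zrightarrow> Some B"
    using entails_insertE[OF assms] .
  obtain \<Gamma> where "set_mset \<Gamma> \<subseteq> G" "image_mset Nabla \<Gamma> = \<Pi>" using image_mset_preimage[OF \<Pi>(1)] .
  with \<Pi>(2) derives_sequents_of[OF \<Pi>(2)] show ?thesis
    by (intro entailsI[OF derives_step1[OF rule_instance.ImpR]]) auto
qed

lemma entails_HImpE:
  assumes "RuleH \<in> X" "formula_of X A" "formula_of X B"
  shows "{A \<sqsupset> B, A} \<tturnstile> B"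
proof -
  have "\<turnstile> {#B, A#} \<Zrightarrow> Some B"
    by (rule derives_antecedent_mono[OF derives_step0[OF rule_instance.Id]]) (use assms in auto)
  then show ?thesis
    by (intro entailsI[OF derives_step2[OF rule_instance.HL[OF assms(1), of _ A] derives_step0[OF rule_instance.Id]]])
      (use assms in auto)
qed

lemma entails_HImpI:
  assumes "RuleH \<in> X" "insert A G \<tturnstile> B" "formula_of X A"
  shows "G \<tturnstile> A \<sqsupset> B"
proof -
  obtain \<Pi> where \<Pi>: "set_mset \<Pi> \<subseteq> G" "\<turnstile> add_mset A \<Pi> \<Zrightarrow> Some B"
    using entails_insertE[OF assms(2,3)] .
  with derives_sequents_of[OF \<Pi>(2)] assms(1) show ?thesis
    by (intro entailsI[OF derives_step1[OF rule_instance.HR]]) auto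
qed

lemma entails_Nabla:
  assumes "G \<tturnstile> A"
  shows "Nabla ` G \<tturnstile> \<nabla> A"
proof -
  obtain \<Gamma> where \<Gamma>: "set_mset \<Gamma> \<subseteq> G" "\<turnstile> \<Gamma> \<Zrightarrow> Some A" using assms unfolding entails_def by blast
  have "\<turnstile> image_mset Nabla \<Gamma> \<Zrightarrow> map_option Nabla (Some A)"
    by (rule derives_step1[OF rule_instance.N[OF rule_N] \<Gamma>(2)])
      (use derives_sequents_of[OF \<Gamma>(2)] in auto)
  then show ?thesis using \<Gamma> by (intro entailsI[of "image_mset Nabla \<Gamma>"]) auto
qed

lemma entails_Nabla_Bot: "{\<nabla> Bot} \<tturnstile> Bot"
proof -
  have "\<turnstile> image_mset Nabla {#Bot#} \<Zrightarrow> map_option Nabla None"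
    by (rule derives_step1[OF rule_instance.N[OF rule_N] derives_step0[OF rule_instance.BotL]]) auto
  then have "\<turnstile> {#\<nabla> Bot#} \<Zrightarrow> Some Bot" by (simp add: derives_None_iff)
  then show ?thesis by (rule entailsI) auto
qed

text \<open>The formula \<open>Top \<^bold>\<rightarrow> C\<close> is the right adjoint of \<open>\<nabla>\<close> at \<open>C\<close>, so \<open>\<nabla>\<close> preserves joins.\<close>

lemma entails_Nabla_Disj:
  assumes "formula_of X A" "formula_of X B"
  shows "{\<nabla> (A \<^bold>\<or> B)} \<tturnstile> \<nabla> A \<^bold>\<or> \<nabla> B"
proof -
  let ?C = "\<nabla> A \<^bold>\<or> \<nabla> B"
  have "{A} \<tturnstile> Top \<^bold>\<rightarrow> ?C" "{B} \<tturnstile> Top \<^bold>\<rightarrow> ?C"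
    by (rule entails_ImpI;
        use assms in \<open>auto intro: entails_mono[OF entails_Disj1] entails_mono[OF entails_Disj2]\<close>)+
  then have "{A \<^bold>\<or> B} \<tturnstile> Top \<^bold>\<rightarrow> ?C" by (rule entails_DisjE) (use assms in auto)
  from entails_Nabla[OF this] have "{\<nabla> (A \<^bold>\<or> B)} \<tturnstile> \<nabla> (Top \<^bold>\<rightarrow> ?C)" by simp
  then show ?thesis by (rule entails_trans2[OF _ entails_Top entails_ImpE]) (use assms in auto)
qed

lemma entails_R: "\<lbrakk>RuleR \<in> X; formula_of X A\<rbrakk> \<Longrightarrow> {A} \<tturnstile> \<nabla> A"
  by (rule entailsI[OF derives_step1[OF rule_instance.R derives_step0[OF rule_instance.Id]]]) auto

lemma entails_L: "\<lbrakk>RuleL \<in> X; formula_of X A\<rbrakk> \<Longrightarrow> {\<nabla> A} \<tturnstile> A"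
  by (rule entailsI[OF derives_step1[OF rule_instance.L derives_step0[OF rule_instance.Id]]]) auto

text \<open>Together with \<open>entails_ImpE\<close> at \<open>Top\<close> this makes A and
  \<open>\<nabla>\<close> (Top \<rightarrow> A) interderivable, so a prime theory can be recovered
  from its image under \<open>nabla_inverse\<close>.\<close>

lemma entails_Fa:
  assumes "RuleFa \<in> X" "formula_of X A"
  shows "{A} \<tturnstile> \<nabla> (Top \<^bold>\<rightarrow> A)"
proof -
  have "\<turnstile> {#Top, A#} \<Zrightarrow> Some A"
    by (rule derives_antecedent_mono[OF derives_step0[OF rule_instance.Id]]) (use assms in auto)
  then show ?thesis
    by (intro entailsI[OF derives_step1[OF rule_instance.Fa]]) (use assms in auto)
qed

section \<open>Prime theories\<close>

text \<open>The prime filters of the Lindenbaum algebra of the V-fragment. Derivations behind the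
  closure condition may pass through formulas with other variables; only hypotheses and conclusion
  lie over V.\<close>

definition prime_theory :: "'a set \<Rightarrow> 'a fm set \<Rightarrow> bool" where
  "prime_theory V x \<longleftrightarrow> x \<subseteq> language X V \<and> (\<forall>A\<in>language X V. x \<tturnstile> A \<longrightarrow> A \<in> x) \<and>
    Bot \<notin> x \<and> (\<forall>A B. A \<^bold>\<or> B \<in> x \<longrightarrow> A \<in> x \<or> B \<in> x)"

lemma prime_theory_language: "\<lbrakk>prime_theory V x; A \<in> x\<rbrakk> \<Longrightarrow> A \<in> language X V"
  by (auto simp: prime_theory_def)

lemma prime_theory_closed: "\<lbrakk>prime_theory V x; x \<tturnstile> A; A \<in> language X V\<rbrakk> \<Longrightarrow> A \<in> x"
  by (auto simp: prime_theory_def)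

lemma prime_theory_closed1:
  "\<lbrakk>prime_theory V x; A \<in> x; {A} \<tturnstile> B; B \<in> language X V\<rbrakk> \<Longrightarrow> B \<in> x"
  by (rule prime_theory_closed) (auto elim: entails_mono)

lemma prime_theory_closed2:
  "\<lbrakk>prime_theory V x; A \<in> x; B \<in> x; {A, B} \<tturnstile> C; C \<in> language X V\<rbrakk> \<Longrightarrow> C \<in> x"
  by (rule prime_theory_closed) (auto elim: entails_mono)

text \<open>The prime filter theorem, by Zorn's lemma. I plays the part of the ideal, and a theory
  maximal among those entailing no member of I is prime.\<close>

lemma prime_separation:
  assumes F: "F \<subseteq> language X V" and I: "I \<subseteq> language X V" "I \<noteq> {}"
    and I_Disj: "\<And>B C. \<lbrakk>B \<in> I; C \<in> I\<rbrakk> \<Longrightarrow> B \<^bold>\<or> C \<in> I"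
    and sep: "\<And>B. B \<in> I \<Longrightarrow> \<not> F \<tturnstile> B"
  obtains x where "prime_theory V x" "F \<subseteq> x" "x \<inter> I = {}"
proof -
  define \<A> where "\<A> = {x. F \<subseteq> x \<and> x \<subseteq> language X V \<and> (\<forall>B\<in>I. \<not> x \<tturnstile> B)}"
  have "\<exists>M\<in>\<A>. \<forall>x\<in>\<A>. M \<subseteq> x \<longrightarrow> x = M"
  proof (rule subset_Zorn_nonempty)
    show "\<A> \<noteq> {}" using F sep by (auto simp: \<A>_def)
  next
    fix \<C> assume \<C>: "\<C> \<noteq> {}" "subset.chain \<A> \<C>"
    have "\<not> \<Union>\<C> \<tturnstile> B" if B: "B \<in> I" for B
    proof
      assume "\<Union>\<C> \<tturnstile> B"
      then obtain \<Gamma> where \<Gamma>: "set_mset \<Gamma> \<subseteq> \<Union>\<C>" "\<turnstile> \<Gamma> \<Zrightarrow> Some B" unfolding entails_def by blast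
      \<comment> \<open>A finite context inside the union of a chain lies in one member of the
        chain.\<close>
      obtain x where "x \<in> \<C>" "set_mset \<Gamma> \<subseteq> x"
        using finite_subset_Union_chain[OF finite_set_mset \<Gamma>(1) \<C>] by blast
      then show False using \<Gamma>(2) B \<C> by (auto simp: \<A>_def subset_chain_def entails_def)
    qed
    then show "\<Union>\<C> \<in> \<A>" using \<C> by (fastforce simp: \<A>_def subset_chain_def)
  qed
  then obtain x where "x \<in> \<A>" and max: "\<And>y. \<lbrakk>y \<in> \<A>; x \<subseteq> y\<rbrakk> \<Longrightarrow> y = x" by blast
  then have x: "F \<subseteq> x" "x \<subseteq> language X V" "\<And>B. B \<in> I \<Longrightarrow> \<not> x \<tturnstile> B" by (auto simp: \<A>_def)
  \<comment> \<open>By maximality, adding any formula outside x makes some member of I derivable;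
    deductive closure and primality both rest on this.\<close>
  have ext: "\<exists>B\<in>I. insert A x \<tturnstile> B" if "A \<in> language X V" "A \<notin> x" for A
  proof (rule ccontr)
    assume "\<not> (\<exists>B\<in>I. insert A x \<tturnstile> B)"
    then have "insert A x \<in> \<A>" using x that by (auto simp: \<A>_def)
    then show False using max that by blast
  qed
  have "prime_theory V x"
    unfolding prime_theory_def
  proof (intro conjI ballI allI impI)
    show "x \<subseteq> language X V" by (fact x)
  next
    fix A assume "A \<in> language X V" "x \<tturnstile> A"
    then show "A \<in> x" using ext x(3) entails_cut by blast
  next
    obtain B where "B \<in> I" using I by blast
    then show "Bot \<notin> x"
      using x(3)[of B] I entails_mono[OF entails_Bot[of B], of x] by (auto dest: language_formula_of)
  next
    fix A B assume AB: "A \<^bold>\<or> B \<in> x"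
    show "A \<in> x \<or> B \<in> x"
    proof (rule ccontr)
      assume "\<not> (A \<in> x \<or> B \<in> x)"
      moreover have L: "A \<in> language X V" "B \<in> language X V" using AB x by fastforce+
      ultimately obtain C D where C: "C \<in> I" "insert A x \<tturnstile> C" and D: "D \<in> I" "insert B x \<tturnstile> D"
        using ext by blast
      have f: "formula_of X C" "formula_of X D" using C D I by (auto simp: language_def)
      have "insert A x \<tturnstile> C \<^bold>\<or> D" using entails_trans[OF C(2) entails_Disj1] f by blast
      moreover have "insert B x \<tturnstile> C \<^bold>\<or> D" using entails_trans[OF D(2) entails_Disj2] f by blast
      ultimately have "insert (A \<^bold>\<or> B) x \<tturnstile> C \<^bold>\<or> D"
        using L by (intro entails_DisjE) (auto dest: language_formula_of)
      then show False using AB C D I_Disj x(3) by (metis insert_absorb)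
    qed
  qed
  moreover have "x \<inter> I = {}"
    using x I by (auto dest!: language_formula_of intro: entails_assumption)
  ultimately show ?thesis using x that by blast
qed

lemma prime_separation_formula:
  assumes F: "F \<subseteq> language X V" and B: "B \<in> language X V" and sep: "\<not> F \<tturnstile> B"
  obtains x where "prime_theory V x" "F \<subseteq> x" "B \<notin> x"
proof -
  \<comment> \<open>The principal ideal of B, since the singleton of B is not closed under
    disjunction as syntax.\<close>
  let ?I = "{C \<in> language X V. {C} \<tturnstile> B}"
  have BI: "B \<in> ?I" using B by (auto intro: entails_assumption language_formula_of)
  obtain x where "prime_theory V x" "F \<subseteq> x" "x \<inter> ?I = {}"
  proof (rule prime_separation[OF F, of ?I])
    show "?I \<noteq> {}" using BI by blast
    show "C \<^bold>\<or> D \<in> ?I" if "C \<in> ?I" "D \<in> ?I" for C D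
      using that by (auto intro: entails_DisjE language_formula_of)
    show "\<not> F \<tturnstile> C" if "C \<in> ?I" for C using that sep entails_trans by blast
  qed auto
  then show ?thesis using BI that by blast
qed

lemma prime_theory_restrict:
  assumes "prime_theory V x" "V' \<subseteq> V"
  shows "prime_theory V' (x \<inter> language X V')"
proof -
  have "A \<in> x" if "x \<inter> language X V' \<tturnstile> A" "A \<in> language X V'" for A
    using that assms by (intro prime_theory_closed[OF assms(1)])
      (auto elim: entails_mono dest: language_mono)
  then show ?thesis using assms(1) unfolding prime_theory_def by fastforce
qed

text \<open>The complement of z in its fragment is closed under disjunction because z is prime.
  Separating from this complement gives a theory that contains z and adds nothing to it over
  \<open>V'\<close>.\<close>

lemma prime_theory_extend:
  assumes V: "V' \<subseteq> V" and z: "prime_theory V' z" and G: "G \<subseteq> language X V"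
    and G_cons: "\<And>B. \<lbrakk>B \<in> language X V'; G \<union> z \<tturnstile> B\<rbrakk> \<Longrightarrow> B \<in> z"
  obtains x where "prime_theory V x" "G \<subseteq> x" "x \<inter> language X V' = z"
proof -
  let ?I = "language X V' - z"
  obtain x where "prime_theory V x" "G \<union> z \<subseteq> x" "x \<inter> ?I = {}"
  proof (rule prime_separation[of "G \<union> z" V ?I])
    show "G \<union> z \<subseteq> language X V" "?I \<subseteq> language X V"
      using z G language_mono[OF V] by (auto simp: prime_theory_def)
    show "?I \<noteq> {}" using z language_simps(3)[of X V'] unfolding prime_theory_def by blast
    show "B \<^bold>\<or> C \<in> ?I" if "B \<in> ?I" "C \<in> ?I" for B C using that z by (auto simp: prime_theory_def)
    show "\<not> G \<union> z \<tturnstile> B" if "B \<in> ?I" for B using that G_cons by blast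
  qed
  then show ?thesis using that z by (blast dest: prime_theory_language)
qed

end

section \<open>The frame map on prime theories\<close>

definition nabla_inverse :: "'a fm set \<Rightarrow> 'a fm set" where
  "nabla_inverse x = {A. \<nabla> A \<in> x}"

lemma in_nabla_inverse [simp]: "A \<in> nabla_inverse x \<longleftrightarrow> \<nabla> A \<in> x"
  by (simp add: nabla_inverse_def)

context stl_theory
begin

text \<open>Closure comes from \<open>N\<close>, properness from the refutability of
  \<open>\<nabla> Bot\<close>, and primality from the distribution of \<open>\<nabla>\<close> over
  disjunction.\<close>

lemma prime_theory_nabla_inverse:
  assumes "prime_theory V x"
  shows "prime_theory V (nabla_inverse x)"
  unfolding prime_theory_def
proof (intro conjI ballI allI impI)
  show "nabla_inverse x \<subseteq> language X V"
    using prime_theory_language[OF assms] by fastforce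
next
  fix A assume "A \<in> language X V" "nabla_inverse x \<tturnstile> A"
  then have "\<nabla> A \<in> x"
    by (intro prime_theory_closed[OF assms entails_mono[OF entails_Nabla]]) auto
  then show "A \<in> nabla_inverse x" by simp
next
  show "Bot \<notin> nabla_inverse x"
    using prime_theory_closed1[OF assms _ entails_Nabla_Bot] assms by (auto simp: prime_theory_def)
next
  fix A B assume AB: "A \<^bold>\<or> B \<in> nabla_inverse x"
  then have L: "A \<in> language X V" "B \<in> language X V"
    using prime_theory_language[OF assms] by fastforce+
  have "\<nabla> A \<^bold>\<or> \<nabla> B \<in> x"
    by (rule prime_theory_closed1[OF assms _ entails_Nabla_Disj])
      (use AB L in \<open>auto dest: language_formula_of\<close>)
  then show "A \<in> nabla_inverse x \<or> B \<in> nabla_inverse x" using assms by (auto simp: prime_theory_def)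
qed

lemma prime_theory_R:
  assumes "RuleR \<in> X" "prime_theory V x"
  shows "x \<subseteq> nabla_inverse x"
proof
  fix A assume A: "A \<in> x"
  have "\<nabla> A \<in> x"
    by (rule prime_theory_closed1[OF assms(2) A entails_R[OF assms(1)]])
      (use prime_theory_language[OF assms(2) A] in \<open>auto dest: language_formula_of\<close>)
  then show "A \<in> nabla_inverse x" by simp
qed

lemma prime_theory_L:
  assumes "RuleL \<in> X" "prime_theory V x"
  shows "nabla_inverse x \<subseteq> x"
proof
  fix A assume A: "A \<in> nabla_inverse x"
  with prime_theory_language[OF assms(2)] have "A \<in> language X V" by fastforce
  with A show "A \<in> x"
    by (auto intro: prime_theory_closed1[OF assms(2)] entails_L[OF assms(1)] dest: language_formula_of)
qed

text \<open>From A in x one gets Top \<rightarrow> A in \<open>nabla_inverse x\<close>, hence in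
  \<open>nabla_inverse y\<close>, and the presence of \<open>Top\<close> in y leads back to
  A.\<close>

lemma prime_theory_Fa:
  assumes "RuleFa \<in> X" "prime_theory V x" "prime_theory V y" "nabla_inverse x \<subseteq> nabla_inverse y"
  shows "x \<subseteq> y"
proof
  fix A assume A: "A \<in> x"
  note L = prime_theory_language[OF assms(2) A]
  have "\<nabla> (Top \<^bold>\<rightarrow> A) \<in> x"
    using prime_theory_closed1[OF assms(2) A entails_Fa] assms(1) L by (auto dest: language_formula_of)
  then have *: "\<nabla> (Top \<^bold>\<rightarrow> A) \<in> y" using assms(4) by auto
  have "Top \<in> y" using prime_theory_closed[OF assms(3) entails_Top] by simp
  with * show "A \<in> y"
    using L by (auto intro: prime_theory_closed2[OF assms(3) _ _ entails_ImpE] dest: language_formula_of)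
qed

section \<open>Membership clauses for the connectives\<close>

lemma prime_theory_Conj_iff:
  assumes "prime_theory V x" "A \<in> language X V" "B \<in> language X V"
  shows "A \<^bold>\<and> B \<in> x \<longleftrightarrow> A \<in> x \<and> B \<in> x"
  using assms language_formula_of[OF assms(2)] language_formula_of[OF assms(3)]
    prime_theory_closed1[OF assms(1) _ entails_Conj1] prime_theory_closed1[OF assms(1) _ entails_Conj2]
    prime_theory_closed2[OF assms(1) _ _ entails_ConjI]
  by (metis language_simps(4))

lemma prime_theory_Disj_iff:
  assumes "prime_theory V x" "A \<in> language X V" "B \<in> language X V"
  shows "A \<^bold>\<or> B \<in> x \<longleftrightarrow> A \<in> x \<or> B \<in> x"
  using assms language_formula_of[OF assms(2)] language_formula_of[OF assms(3)]
    prime_theory_closed1[OF assms(1) _ entails_Disj1] prime_theory_closed1[OF assms(1) _ entails_Disj2]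
  by (metis language_simps(5) prime_theory_def)

lemma prime_theory_Imp_iff:
  assumes x: "prime_theory V x" and A: "A \<in> language X V" and B: "B \<in> language X V"
  shows "A \<^bold>\<rightarrow> B \<in> x \<longleftrightarrow>
    (\<forall>z. prime_theory V z \<longrightarrow> x \<subseteq> nabla_inverse z \<longrightarrow> A \<in> z \<longrightarrow> B \<in> z)"
proof (intro iffI allI impI)
  fix z assume "A \<^bold>\<rightarrow> B \<in> x" and z: "prime_theory V z" and "x \<subseteq> nabla_inverse z" "A \<in> z"
  then have "\<nabla> (A \<^bold>\<rightarrow> B) \<in> z" by auto
  with z \<open>A \<in> z\<close> show "B \<in> z"
    using A B by (auto intro: prime_theory_closed2[OF z _ _ entails_ImpE] dest: language_formula_of)
next
  assume *: "\<forall>z. prime_theory V z \<longrightarrow> x \<subseteq> nabla_inverse z \<longrightarrow> A \<in> z \<longrightarrow> B \<in> z"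
  \<comment> \<open>The inclusion \<open>x \<subseteq> nabla_inverse z\<close> says that z contains
    \<open>\<nabla> D\<close> for every D in x. If the entailment failed, separation would yield
    such a z with A but without B.\<close>
  have "insert A (Nabla ` x) \<tturnstile> B"
  proof (rule ccontr)
    assume sep: "\<not> insert A (Nabla ` x) \<tturnstile> B"
    have "insert A (Nabla ` x) \<subseteq> language X V" using A prime_theory_language[OF x] by auto
    from prime_separation_formula[OF this B sep] show False using * by (auto simp: subset_iff)
  qed
  then show "A \<^bold>\<rightarrow> B \<in> x"
    using A B by (auto intro: prime_theory_closed[OF x entails_ImpI] language_formula_of)
qed

lemma prime_theory_HImp_iff:
  assumes H: "RuleH \<in> X" and x: "prime_theory V x" and A: "A \<in> language X V" and B: "B \<in> language X V"
  shows "A \<sqsupset> B \<in> x \<longleftrightarrow> (\<forall>z. prime_theory V z \<longrightarrow> x \<subseteq> z \<longrightarrow> A \<in> z \<longrightarrow> B \<in> z)"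
proof (intro iffI allI impI)
  fix z assume "A \<sqsupset> B \<in> x" and z: "prime_theory V z" and "x \<subseteq> z" "A \<in> z"
  then show "B \<in> z"
    using A B H by (auto intro: prime_theory_closed2[OF z _ _ entails_HImpE] dest: language_formula_of)
next
  assume *: "\<forall>z. prime_theory V z \<longrightarrow> x \<subseteq> z \<longrightarrow> A \<in> z \<longrightarrow> B \<in> z"
  have "insert A x \<tturnstile> B"
  proof (rule ccontr)
    assume sep: "\<not> insert A x \<tturnstile> B"
    have "insert A x \<subseteq> language X V" using A prime_theory_language[OF x] by auto
    from prime_separation_formula[OF this B sep] show False using * by auto
  qed
  then show "A \<sqsupset> B \<in> x"
    using A B H by (auto intro: prime_theory_closed[OF x entails_HImpI] language_formula_of)
qed

text \<open>A prime theory is closed under conjunction, so the finitely many members used in a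
  derivation merge into a single A, which an implication rule can then discharge.\<close>

lemma prime_theory_collect:
  assumes z: "prime_theory V z" and B: "G \<union> z \<tturnstile> B"
  obtains A where "A \<in> z" "insert A G \<tturnstile> B"
proof -
  \<comment> \<open>H is arbitrary so that the induction can move a formula from F into the
    context.\<close>
  have *: "\<exists>A\<in>z. insert A H \<tturnstile> B" if "finite F" "F \<subseteq> z" "H \<union> F \<tturnstile> B" for F H
    using that
  proof (induction F arbitrary: H rule: finite_induct)
    case empty
    have "Top \<in> z" using prime_theory_closed[OF z entails_Top] by simp
    with empty show ?case by (auto elim: entails_mono)
  next
    case (insert D F)
    then have "insert D H \<union> F \<tturnstile> B" "F \<subseteq> z" by auto
    with insert.IH[of "insert D H"] obtain A where A: "A \<in> z" "insert A (insert D H) \<tturnstile> B" by blast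
    have L: "A \<in> language X V" "D \<in> language X V" using A insert.prems prime_theory_language[OF z] by auto
    then have f: "formula_of X A" "formula_of X D" by (auto dest: language_formula_of)
    have "insert (A \<^bold>\<and> D) H \<tturnstile> D" using entails_mono[OF entails_Conj2[OF f]] by simp
    moreover have "insert D (insert (A \<^bold>\<and> D) H) \<tturnstile> A" using entails_mono[OF entails_Conj1[OF f]] by simp
    then have "insert D (insert (A \<^bold>\<and> D) H) \<tturnstile> B"
      by (rule entails_cut) (rule entails_mono[OF A(2)], auto)
    ultimately have "insert (A \<^bold>\<and> D) H \<tturnstile> B" by (rule entails_cut)
    moreover have "A \<^bold>\<and> D \<in> z" using prime_theory_Conj_iff[OF z L] A insert.prems by simp
    ultimately show ?case by blast
  qed
  obtain \<Gamma> where \<Gamma>: "set_mset \<Gamma> \<subseteq> G \<union> z" "\<turnstile> \<Gamma> \<Zrightarrow> Some B" using B unfolding entails_def by blast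
  then have "G \<union> (set_mset \<Gamma> \<inter> z) \<tturnstile> B" by (intro entailsI) auto
  then show ?thesis using *[of "set_mset \<Gamma> \<inter> z" G] that by auto
qed

lemma prime_theory_sequent:
  assumes x: "prime_theory V x" and "\<turnstile> \<Gamma> \<Zrightarrow> \<Delta>" "set_mset \<Gamma> \<subseteq> x" "set_option \<Delta> \<subseteq> language X V"
  shows "\<exists>A\<in>set_option \<Delta>. A \<in> x"
proof (cases \<Delta>)
  case None
  then have "x \<tturnstile> Bot" using assms by (auto simp: derives_None_iff intro: entailsI)
  then show ?thesis using prime_theory_closed[OF x] x by (auto simp: prime_theory_def)
next
  case (Some A)
  then show ?thesis using assms by (auto intro: prime_theory_closed[OF x] entailsI)
qed

lemma prime_theory_refutes_sequent:
  assumes "\<not> \<turnstile> \<Gamma> \<Zrightarrow> \<Delta>" "set_mset \<Gamma> \<subseteq> language X V" "set_option \<Delta> \<subseteq> language X V"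
  obtains x where "prime_theory V x" "set_mset \<Gamma> \<subseteq> x" "\<forall>A\<in>set_option \<Delta>. A \<notin> x"
proof -
  \<comment> \<open>\<open>Bot\<close> stands in for an empty succedent.\<close>
  define B where "B = (case \<Delta> of None \<Rightarrow> Bot | Some A \<Rightarrow> A)"
  have B: "B \<in> language X V" using assms(3) by (auto simp: B_def split: option.splits)
  have "\<not> \<turnstile> \<Gamma> \<Zrightarrow> Some B"
    using assms(1) by (auto simp: B_def derives_None_iff split: option.splits)
  moreover have "\<forall>A\<in>#\<Gamma>. formula_of X A" using assms(2) by (auto dest: language_formula_of)
  ultimately have "\<not> set_mset \<Gamma> \<tturnstile> B"
    unfolding entails_def using derives_antecedent_mono by blast
  then obtain x where "prime_theory V x" "set_mset \<Gamma> \<subseteq> x" "B \<notin> x"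
    using prime_separation_formula[OF assms(2) B] by blast
  then show ?thesis using that by (cases \<Delta>) (simp_all add: B_def)
qed

text \<open>The next three lemmas say that restriction to a smaller set of variables is a surjective
  bounded morphism between canonical frames.\<close>

lemma prime_theory_lift:
  assumes "V' \<subseteq> V" "prime_theory V' z"
  obtains x where "prime_theory V x" "x \<inter> language X V' = z"
  by (rule prime_theory_extend[OF assms, of "{}"])
    (use assms in \<open>auto intro: prime_theory_closed\<close>)

lemma prime_theory_lift_nabla:
  assumes V: "V' \<subseteq> V" and x: "prime_theory V x" and z: "prime_theory V' z"
    and sub: "x \<inter> language X V' \<subseteq> nabla_inverse z"
  obtains w where "prime_theory V w" "x \<subseteq> nabla_inverse w" "w \<inter> language X V' = z"
proof -
  have "B \<in> z" if B: "B \<in> language X V'" "Nabla ` x \<union> z \<tturnstile> B" for B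
  proof -
    obtain A where A: "A \<in> z" "insert A (Nabla ` x) \<tturnstile> B"
      using prime_theory_collect[OF z B(2)] .
    have AL: "A \<in> language X V'" using prime_theory_language[OF z A(1)] .
    \<comment> \<open>Discharging A puts A \<rightarrow> B into x. Both A and B lie in the smaller
      fragment, so this implication survives the restriction and reaches z under
      \<open>\<nabla>\<close>.\<close>
    have "A \<^bold>\<rightarrow> B \<in> x"
      using A AL B(1) language_mono[OF V, of X]
      by (intro prime_theory_closed[OF x entails_ImpI]) (auto dest: language_formula_of)
    then have "\<nabla> (A \<^bold>\<rightarrow> B) \<in> z" using sub AL B(1) by auto
    then show ?thesis using A(1) AL B(1)
      by (auto intro: prime_theory_closed2[OF z _ _ entails_ImpE] dest: language_formula_of)
  qed
  moreover have "Nabla ` x \<subseteq> language X V" using prime_theory_language[OF x] by auto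
  ultimately obtain w where "prime_theory V w" "Nabla ` x \<subseteq> w" "w \<inter> language X V' = z"
    using prime_theory_extend[OF V z, of "Nabla ` x"] by blast
  then show ?thesis using that by (auto simp: subset_iff)
qed

lemma prime_theory_lift_H:
  assumes H: "RuleH \<in> X" and V: "V' \<subseteq> V" and x: "prime_theory V x" and z: "prime_theory V' z"
    and sub: "x \<inter> language X V' \<subseteq> z"
  obtains w where "prime_theory V w" "x \<subseteq> w" "w \<inter> language X V' = z"
proof -
  have "B \<in> z" if B: "B \<in> language X V'" "x \<union> z \<tturnstile> B" for B
  proof -
    obtain A where A: "A \<in> z" "insert A x \<tturnstile> B"
      using prime_theory_collect[OF z B(2)] .
    have AL: "A \<in> language X V'" using prime_theory_language[OF z A(1)] .
    \<comment> \<open>Here x enters without \<open>\<nabla>\<close>, so A is discharged by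
      \<open>\<sqsupset>\<close> instead.\<close>
    have "A \<sqsupset> B \<in> x"
      using A AL B(1) language_mono[OF V, of X] H
      by (intro prime_theory_closed[OF x entails_HImpI]) (auto dest: language_formula_of)
    then have "A \<sqsupset> B \<in> z" using sub AL B(1) H by auto
    then show ?thesis using A(1) AL B(1) H
      by (auto intro: prime_theory_closed2[OF z _ _ entails_HImpE] dest: language_formula_of)
  qed
  moreover have "x \<subseteq> language X V" using prime_theory_language[OF x] by auto
  ultimately show ?thesis
    using prime_theory_extend[OF V z, of x] that by blast
qed

end

section \<open>Bounded morphisms into canonical frames\<close>

text \<open>Abstracts from the two projections of the amalgam, so that one truth lemma serves both.
  The back conditions ask for a world mapped exactly to the prescribed z, along the relation
  interpreting \<open>\<rightarrow>\<close> and along the one interpreting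
  \<open>\<sqsupset>\<close>.\<close>

locale canonical_morphism = kripke_model X W le \<pi> val + stl_theory X T
  for X :: "add_rule set" and W :: "'w set" and le :: "'w \<Rightarrow> 'w \<Rightarrow> bool" and \<pi> :: "'w \<Rightarrow> 'w"
    and val :: "'w \<Rightarrow> 'a \<Rightarrow> bool" and T :: "'a sequent set" +
  fixes V :: "'a set" and f :: "'w \<Rightarrow> 'a fm set"
  assumes f_prime: "w \<in> W \<Longrightarrow> prime_theory V (f w)"
    and f_mono: "\<lbrakk>v \<in> W; w \<in> W; le v w\<rbrakk> \<Longrightarrow> f v \<subseteq> f w"
    and f_pi: "w \<in> W \<Longrightarrow> f (\<pi> w) = nabla_inverse (f w)"
    and f_val: "\<lbrakk>w \<in> W; p \<in> V\<rbrakk> \<Longrightarrow> val w p \<longleftrightarrow> Atom p \<in> f w"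
    and f_back: "\<lbrakk>w \<in> W; prime_theory V z; f w \<subseteq> nabla_inverse z\<rbrakk> \<Longrightarrow> \<exists>v\<in>W. le w (\<pi> v) \<and> f v = z"
    and f_back_H: "\<lbrakk>RuleH \<in> X; w \<in> W; prime_theory V z; f w \<subseteq> z\<rbrakk> \<Longrightarrow> \<exists>v\<in>W. le w v \<and> f v = z"
begin

text \<open>The truth lemma. In the implication cases, monotonicity of f and the back conditions
  allow quantification over worlds v to be exchanged for quantification over prime theories
  z.\<close>

lemma sat_iff_mem: "\<lbrakk>w \<in> W; A \<in> language X V\<rbrakk> \<Longrightarrow> sat w A \<longleftrightarrow> A \<in> f w"
proof (induction A arbitrary: w)
  case (Atom p)
  then show ?case by (simp add: f_val)
next
  case Top
  then show ?case using prime_theory_closed[OF f_prime entails_Top] by simp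
next
  case Bot
  then show ?case using f_prime by (auto simp: prime_theory_def)
next
  case (Conj A B)
  then show ?case using prime_theory_Conj_iff[OF f_prime] by simp
next
  case (Disj A B)
  then show ?case using prime_theory_Disj_iff[OF f_prime] by simp
next
  case (Imp A B)
  then have L: "A \<in> language X V" "B \<in> language X V" by auto
  have "sat w (A \<^bold>\<rightarrow> B) \<longleftrightarrow> (\<forall>v\<in>W. le w (\<pi> v) \<longrightarrow> A \<in> f v \<longrightarrow> B \<in> f v)"
    using Imp.IH L by simp
  also have "\<dots> \<longleftrightarrow> (\<forall>z. prime_theory V z \<longrightarrow> f w \<subseteq> nabla_inverse z \<longrightarrow> A \<in> z \<longrightarrow> B \<in> z)"
    using f_back[OF Imp.prems(1)] f_mono[OF Imp.prems(1) pi_in] f_pi f_prime by metis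
  finally show ?case using prime_theory_Imp_iff[OF f_prime[OF Imp.prems(1)] L] by simp
next
  case (Nabla A)
  then show ?case by (simp add: pi_in f_pi)
next
  case (HImp A B)
  then have L: "RuleH \<in> X" "A \<in> language X V" "B \<in> language X V" by auto
  have "sat w (A \<sqsupset> B) \<longleftrightarrow> (\<forall>v\<in>W. le w v \<longrightarrow> A \<in> f v \<longrightarrow> B \<in> f v)"
    using HImp.IH L by simp
  also have "\<dots> \<longleftrightarrow> (\<forall>z. prime_theory V z \<longrightarrow> f w \<subseteq> z \<longrightarrow> A \<in> z \<longrightarrow> B \<in> z)"
    using f_back_H[OF L(1) HImp.prems(1)] f_mono[OF HImp.prems(1)] f_prime by metis
  finally show ?case using prime_theory_HImp_iff[OF L(1) f_prime[OF HImp.prems(1)] L(2,3)] by simp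
qed

end

section \<open>Deductive interpolation\<close>

lemma STL_derives_trans:
  assumes "STL_derives X TT S" "\<And>U. U \<in> TT \<Longrightarrow> STL_derives X SS U"
  shows "STL_derives X SS S"
  using assms(1) by induction (auto intro: assms(2) STL_derives.step)

lemma vars_sequent_subset_iff:
  assumes "S \<in> sequents_of X"
  shows "vars {S} \<subseteq> V \<longleftrightarrow>
    set_mset (antecedent S) \<subseteq> language X V \<and> set_option (succedent S) \<subseteq> language X V"
  using assms by (auto simp: vars_def language_def sequents_of_def)

theorem theorem6p7:
  fixes C :: "add_rule set" and SS :: "'a sequent set" and S :: "'a sequent"
  assumes "C \<subseteq> {RuleH, RuleR, RuleL, RuleFa}"
    and "SS \<subseteq> sequents_of ({RuleN, RuleD} \<union> C)"
    and "S \<in> sequents_of ({RuleN, RuleD} \<union> C)"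
    and "STL_derives ({RuleN, RuleD} \<union> C) SS S"
  shows "\<exists>TT \<subseteq> sequents_of ({RuleN, RuleD} \<union> C).
    vars TT \<subseteq> vars SS \<inter> vars {S} \<and>
    STL_derives ({RuleN, RuleD} \<union> C) TT S \<and>
    (\<forall>T \<in> TT. STL_derives ({RuleN, RuleD} \<union> C) SS T)"
proof -
  define X where "X = {RuleN, RuleD} \<union> C"
  define V1 where "V1 = vars SS"
  define V2 where "V2 = vars {S}"
  define V0 where "V0 = V1 \<inter> V2"
  define TT where "TT = {U \<in> sequents_of X. vars {U} \<subseteq> V0 \<and> STL_derives X SS U}"
  have V0: "V0 \<subseteq> V1" "V0 \<subseteq> V2" by (auto simp: V0_def)
  interpret A: stl_theory X SS
    by unfold_locales (use assms(2) in \<open>auto simp: X_def\<close>)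
  interpret B: stl_theory X TT
    by unfold_locales (auto simp: X_def TT_def)
  \<comment> \<open>A consequence of \<open>SS\<close> over the common variables is itself a member
    of \<open>TT\<close>, and conversely every consequence of \<open>TT\<close> is one of
    \<open>SS\<close>.\<close>
  have entails_iff: "A.entails G D \<longleftrightarrow> B.entails G D"
    if "G \<subseteq> language X V0" "D \<in> language X V0" for G D
  proof -
    have "\<Gamma> \<Zrightarrow> Some D \<in> TT" if "set_mset \<Gamma> \<subseteq> G" "STL_derives X SS (\<Gamma> \<Zrightarrow> Some D)" for \<Gamma>
      using that \<open>G \<subseteq> _\<close> \<open>D \<in> _\<close> A.derives_sequents_of[OF that(2)]
        vars_sequent_subset_iff[of "\<Gamma> \<Zrightarrow> Some D" X V0]
      by (auto simp: TT_def)
    moreover have "STL_derives X TT U \<Longrightarrow> STL_derives X SS U" for U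
      by (erule STL_derives_trans) (simp add: TT_def)
    ultimately show ?thesis
      unfolding A.entails_def B.entails_def by (blast intro: STL_derives.premise)
  qed
  have prime_iff: "A.prime_theory V0 z \<longleftrightarrow> B.prime_theory V0 z" for z
    unfolding A.prime_theory_def B.prime_theory_def using entails_iff by blast
  define W where "W = {w. A.prime_theory V1 (fst w) \<and> B.prime_theory V2 (snd w) \<and>
    fst w \<inter> language X V0 = snd w \<inter> language X V0}"
  define le where "le v w \<longleftrightarrow> fst v \<subseteq> fst w \<and> snd v \<subseteq> snd w" for v w :: "'a fm set \<times> 'a fm set"
  define \<pi> where "\<pi> w = (nabla_inverse (fst w), nabla_inverse (snd w))" for w :: "'a fm set \<times> 'a fm set"
  \<comment> \<open>An atom of \<open>V1\<close> occurring in the second component lies in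
    \<open>V0\<close>, where the components agree. So on \<open>V1\<close> the union gives the same
    atoms as the first component, and symmetrically on \<open>V2\<close>.\<close>
  define val where "val w p \<longleftrightarrow> Atom p \<in> fst w \<union> snd w" for w :: "'a fm set \<times> 'a fm set" and p
  have agree: "D \<in> fst w \<longleftrightarrow> D \<in> snd w" if "w \<in> W" "D \<in> language X V0" for w D
    using that unfolding W_def by blast
  \<comment> \<open>A formula D is over \<open>V0\<close> iff \<open>\<nabla> D\<close> is, so
    agreement of the components is preserved.\<close>
  have pi_W: "\<pi> w \<in> W" if "w \<in> W" for w
    using that A.prime_theory_nabla_inverse B.prime_theory_nabla_inverse language_simps(7)[of _ X V0]
    by (fastforce simp: W_def \<pi>_def)
  interpret kripke_model X W le \<pi> val
  proof unfold_locales
    show "le v w" if "RuleFa \<in> X" "v \<in> W" "w \<in> W" "le (\<pi> v) (\<pi> w)" for v w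
      using that A.prime_theory_Fa[OF that(1), of V1 "fst v" "fst w"]
        B.prime_theory_Fa[OF that(1), of V2 "snd v" "snd w"]
      by (simp add: W_def le_def \<pi>_def)
    show "le w (\<pi> w)" if "RuleR \<in> X" "w \<in> W" for w
      using that A.prime_theory_R[of V1 "fst w"] B.prime_theory_R[of V2 "snd w"]
      by (simp add: W_def le_def \<pi>_def)
    show "le (\<pi> w) w" if "RuleL \<in> X" "w \<in> W" for w
      using that A.prime_theory_L[of V1 "fst w"] B.prime_theory_L[of V2 "snd w"]
      by (simp add: W_def le_def \<pi>_def)
  qed (fact pi_W | force simp: le_def \<pi>_def val_def)+
  \<comment> \<open>To be lifted to the other component, a restriction must count as a prime theory
    for the other premise set; the coincidence over \<open>V0\<close> provides this.\<close>
  have restrict: "B.prime_theory V0 (x \<inter> language X V0)" if "A.prime_theory V1 x" for x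
    using A.prime_theory_restrict[OF that V0(1)] prime_iff by simp
  have restrict': "A.prime_theory V0 (y \<inter> language X V0)" if "B.prime_theory V2 y" for y
    using B.prime_theory_restrict[OF that V0(2)] prime_iff by simp
  interpret f: canonical_morphism X W le \<pi> val SS V1 fst
  proof unfold_locales
    fix w p assume w: "w \<in> W" and p: "p \<in> V1"
    have "Atom p \<in> snd w \<Longrightarrow> Atom p \<in> language X V0"
      using w p B.prime_theory_language by (fastforce simp: W_def V0_def)
    then show "val w p \<longleftrightarrow> Atom p \<in> fst w" using agree[OF w] unfolding val_def by blast
  next
    fix w z assume w: "w \<in> W" and z: "A.prime_theory V1 z" and sub: "fst w \<subseteq> nabla_inverse z"
    \<comment> \<open>The first component of the successor is prescribed as z; the second is
      obtained by lifting the common part of z from \<open>snd w\<close>.\<close>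
    have "snd w \<inter> language X V0 \<subseteq> nabla_inverse (z \<inter> language X V0)"
    proof
      fix D assume "D \<in> snd w \<inter> language X V0"
      then have "D \<in> fst w" "D \<in> language X V0" using agree[OF w] by blast+
      then show "D \<in> nabla_inverse (z \<inter> language X V0)" using sub by auto
    qed
    then obtain y where "B.prime_theory V2 y" "snd w \<subseteq> nabla_inverse y"
        "y \<inter> language X V0 = z \<inter> language X V0"
      using B.prime_theory_lift_nabla[OF V0(2) _ restrict[OF z]] w unfolding W_def by blast
    then show "\<exists>v\<in>W. le w (\<pi> v) \<and> fst v = z"
      using z sub by (intro bexI[of _ "(z, y)"]) (simp_all add: W_def le_def \<pi>_def)
  next
    fix w z assume H: "RuleH \<in> X" and w: "w \<in> W" and z: "A.prime_theory V1 z" and sub: "fst w \<subseteq> z"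
    have "snd w \<inter> language X V0 \<subseteq> z \<inter> language X V0"
      using agree[OF w] sub by blast
    then obtain y where "B.prime_theory V2 y" "snd w \<subseteq> y" "y \<inter> language X V0 = z \<inter> language X V0"
      using B.prime_theory_lift_H[OF H V0(2) _ restrict[OF z]] w unfolding W_def by blast
    then show "\<exists>v\<in>W. le w v \<and> fst v = z"
      using z sub by (intro bexI[of _ "(z, y)"]) (simp_all add: W_def le_def)
  qed (simp_all add: W_def le_def \<pi>_def)
  interpret g: canonical_morphism X W le \<pi> val TT V2 snd
  proof unfold_locales
    fix w p assume w: "w \<in> W" and p: "p \<in> V2"
    have "Atom p \<in> fst w \<Longrightarrow> Atom p \<in> language X V0"
      using w p A.prime_theory_language by (fastforce simp: W_def V0_def)
    then show "val w p \<longleftrightarrow> Atom p \<in> snd w" using agree[OF w] unfolding val_def by blast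
  next
    fix w z assume w: "w \<in> W" and z: "B.prime_theory V2 z" and sub: "snd w \<subseteq> nabla_inverse z"
    have "fst w \<inter> language X V0 \<subseteq> nabla_inverse (z \<inter> language X V0)"
    proof
      fix D assume "D \<in> fst w \<inter> language X V0"
      then have "D \<in> snd w" "D \<in> language X V0" using agree[OF w] by blast+
      then show "D \<in> nabla_inverse (z \<inter> language X V0)" using sub by auto
    qed
    then obtain x where "A.prime_theory V1 x" "fst w \<subseteq> nabla_inverse x"
        "x \<inter> language X V0 = z \<inter> language X V0"
      using A.prime_theory_lift_nabla[OF V0(1) _ restrict'[OF z]] w unfolding W_def by blast
    then show "\<exists>v\<in>W. le w (\<pi> v) \<and> snd v = z"
      using z sub by (intro bexI[of _ "(x, z)"]) (simp_all add: W_def le_def \<pi>_def)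
  next
    fix w z assume H: "RuleH \<in> X" and w: "w \<in> W" and z: "B.prime_theory V2 z" and sub: "snd w \<subseteq> z"
    have "fst w \<inter> language X V0 \<subseteq> z \<inter> language X V0"
      using agree[OF w] sub by blast
    then obtain x where "A.prime_theory V1 x" "fst w \<subseteq> x" "x \<inter> language X V0 = z \<inter> language X V0"
      using A.prime_theory_lift_H[OF H V0(1) _ restrict'[OF z]] w unfolding W_def by blast
    then show "\<exists>v\<in>W. le w v \<and> snd v = z"
      using z sub by (intro bexI[of _ "(x, z)"]) (simp_all add: W_def le_def)
  qed (simp_all add: W_def le_def \<pi>_def)
  \<comment> \<open>Each first component is a prime theory of \<open>SS\<close> and so respects the
    sequents of \<open>SS\<close>; the truth lemma for \<open>fst\<close> transfers this to the
    model.\<close>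
  have "valid U" if U: "U \<in> SS" for U
    unfolding valid_def
  proof (intro ballI impI)
    fix w assume w: "w \<in> W" and sat: "\<forall>D\<in>#antecedent U. sat w D"
    have "vars {U} \<subseteq> V1" using U by (auto simp: V1_def vars_def)
    then have L: "set_mset (antecedent U) \<subseteq> language X V1" "set_option (succedent U) \<subseteq> language X V1"
      using U A.T_sequents vars_sequent_subset_iff[of U X V1] by auto
    have "STL_derives X SS (antecedent U \<Zrightarrow> succedent U)" using U by (simp add: STL_derives.premise)
    moreover have "set_mset (antecedent U) \<subseteq> fst w" using sat L f.sat_iff_mem[OF w] by blast
    ultimately have "\<exists>D\<in>set_option (succedent U). D \<in> fst w"
      using A.prime_theory_sequent[OF f.f_prime[OF w]] L by blast
    then show "\<exists>D\<in>set_option (succedent U). sat w D" using L f.sat_iff_mem[OF w] by blast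
  qed
  then have valid: "valid S" using soundness assms(4) unfolding X_def by blast
  have L: "set_mset (antecedent S) \<subseteq> language X V2" "set_option (succedent S) \<subseteq> language X V2"
    using vars_sequent_subset_iff[of S X V2] assms(3) by (auto simp: X_def V2_def)
  have "STL_derives X TT S"
  proof (rule ccontr)
    assume "\<not> STL_derives X TT S"
    then obtain y where y: "B.prime_theory V2 y" "set_mset (antecedent S) \<subseteq> y"
        "\<forall>D\<in>set_option (succedent S). D \<notin> y"
      using B.prime_theory_refutes_sequent[OF _ L] by auto
    \<comment> \<open>The refuting y is completed to a world of the amalgam, at which the truth
      lemma for \<open>snd\<close> contradicts the validity of S.\<close>
    obtain x where "A.prime_theory V1 x" "x \<inter> language X V0 = y \<inter> language X V0"
      using A.prime_theory_lift[OF V0(1) restrict'[OF y(1)]] .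
    then have w: "(x, y) \<in> W" using y by (simp add: W_def)
    show False using valid w y L g.sat_iff_mem[OF w] unfolding valid_def by fastforce
  qed
  moreover have "TT \<subseteq> sequents_of X" "vars TT \<subseteq> V0" "\<forall>U\<in>TT. STL_derives X SS U"
    by (auto simp: TT_def vars_def)
  ultimately show ?thesis unfolding X_def V0_def V1_def V2_def by blast
qed

end
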